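(* Let $A\in\mathbb{R}^{n\times n}$ be an irreducible monotone matrix. Let $\{\overline{\lambda}_k\}_{k\ge 0}$ be generated by the inexact Noda iteration (INI) applied to $A$ with relaxation factors $\gamma_k$ satisfying $0\le\gamma_k\le\gamma<1$ for a constant $\gamma$, that is, with residuals satisfying $\|\mathbf{f}_k\|\le \gamma_k\,\mathrm{sep}(0,A)\min(\mathbf{x}_k)$ and the update $\overline{\lambda}_{k+1}=\overline{\lambda}_k-(1-\gamma_k)\min\left(\frac{\mathbf{x}_k}{\mathbf{y}_{k+1}}\right)$ for all $k\ge 0$, where $\overline{\lambda}_0>\rho(A^{-1})$ and $\mathbf{x}_k\neq\mathbf{x}$ for all $k$. Then $\{\overline{\lambda}_k\}$ is monotonically decreasing and $\lim_{k\to\infty}\overline{\lambda}_k^{-1}=\sigma_{\min}(A)$.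
   Context: A real square matrix $A$ is monotone if it is nonsingular and $A^{-1}\ge 0$ entrywise. A matrix is reducible if it can be brought to block upper-triangular form by a simultaneous row/column permutation, and irreducible otherwise. $\rho(\cdot)$ is the spectral radius and $\sigma_{\min}(A)=\min\{|\lambda| : \lambda \text{ an eigenvalue of } A\}$; for monotone $A$, $\sigma_{\min}(A)=\rho(A^{-1})^{-1}$. $\|\cdot\|$ is the 2-norm for vectors and matrices. $\mathrm{sep}(0,A)=\|A^{-1}\|^{-1}$. For a vector $\mathbf{v}$, $\min(\mathbf{v})$ is its smallest entry, and for positive vectors $\mathbf{v},\mathbf{w}$, $\min\left(\frac{\mathbf{w}}{\mathbf{v}}\right)=\min_i \mathbf{w}^{(i)}/\mathbf{v}^{(i)}$. $\mathbf{x}>0$ denotes the unit-length positive eigenvector of $A^{-1}$ for the simple eigenvalue $\rho(A^{-1})$. Inexact Noda iteration (INI): start with a scalar $\overline{\lambda}_0$ and a vector $\mathbf{x}_0>0$ with $\|\mathbf{x}_0\|=1$. For $k=0,1,2,\dots$: $\mathbf{y}_{k+1}$ is the vector with $(\overline{\lambda}_kA-I)\mathbf{y}_{k+1}=A\mathbf{x}_k+\mathbf{f}_k$, where $\mathbf{f}_k$ is any residual vector with $\|\mathbf{f}_k\|\le\gamma_k\,\mathrm{sep}(0,A)\min(\mathbf{x}_k)$; then $\mathbf{x}_{k+1}=\mathbf{y}_{k+1}/\|\mathbf{y}_{k+1}\|$ and $\overline{\lambda}_{k+1}=\overline{\lambda}_k-(1-\gamma_k)\min\left(\frac{\mathbf{x}_k}{\mathbf{y}_{k+1}}\right)$.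 The iteration is considered as an infinite sequence, with no stopping test. *)

theory Defs
  imports "HOL-Analysis.Analysis"
begin

(* Complex eigenvalues of a real matrix. *)
definition mat_spectrum :: "real^'n^'n \<Rightarrow> complex set" where
  "mat_spectrum A =
     {\<mu>. \<exists>v. v \<noteq> 0 \<and> (\<chi> i j. complex_of_real (A $ i $ j)) *v v = \<mu> *s v}"

definition spec_radius :: "real^'n^'n \<Rightarrow> real" where
  "spec_radius A = Max (cmod ` mat_spectrum A)"

definition sigma_min :: "real^'n^'n \<Rightarrow> real" where
  "sigma_min A = Min (cmod ` mat_spectrum A)"

definition monotone_mat :: "real^'n^'n \<Rightarrow> bool" where
  "monotone_mat A \<longleftrightarrow> invertible A \<and> (\<forall>i j. 0 \<le> matrix_inv A $ i $ j)"

(* The index type carries no order, so p lists the indices in the permuted order; in that order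
   the matrix is block upper triangular with square diagonal blocks of sizes r and n - r. *)
definition reducible_mat :: "real^'n^'n \<Rightarrow> bool" where
  "reducible_mat A \<longleftrightarrow>
     (\<exists>(p :: nat \<Rightarrow> 'n) r. bij_betw p {..<CARD('n)} UNIV \<and> 0 < r \<and> r < CARD('n) \<and>
        (\<forall>i j. r \<le> i \<and> i < CARD('n) \<and> j < r \<longrightarrow> A $ p i $ p j = 0))"

definition irreducible_mat :: "real^'n^'n \<Rightarrow> bool" where
  "irreducible_mat A \<longleftrightarrow> \<not> reducible_mat A"

(* The matrix 2-norm is the operator norm: the norm of the type real^'n^'n is the Frobenius norm. *)
definition sep0 :: "real^'n^'n \<Rightarrow> real" where
  "sep0 A = inverse (onorm ((*v) (matrix_inv A)))"

definition pos_vec :: "real^'n \<Rightarrow> bool" where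
  "pos_vec v \<longleftrightarrow> (\<forall>i. 0 < v $ i)"

definition min_entry :: "real^'n \<Rightarrow> real" where
  "min_entry v = Min (range (\<lambda>i. v $ i))"

definition min_ratio :: "real^'n \<Rightarrow> real^'n \<Rightarrow> real" where
  "min_ratio w v = Min (range (\<lambda>i. w $ i / v $ i))"

(* Exists and is unique for irreducible nonnegative B, by the Perron-Frobenius theorem. *)
definition perron_vec :: "real^'n^'n \<Rightarrow> real^'n" where
  "perron_vec B = (THE v. pos_vec v \<and> norm v = 1 \<and> B *v v = spec_radius B *\<^sub>R v)"

(* lam, x, y, f is a run of the inexact Noda iteration on A with relaxation factors gam.
   The value y 0 is not used. *)
definition inexact_noda ::
  "real^'n^'n \<Rightarrow> (nat \<Rightarrow> real) \<Rightarrow> (nat \<Rightarrow> real) \<Rightarrow> (nat \<Rightarrow> real^'n) \<Rightarrow> (nat \<Rightarrow> real^'n)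
     \<Rightarrow> (nat \<Rightarrow> real^'n) \<Rightarrow> bool" where
  "inexact_noda A gam lam x y f \<longleftrightarrow>
     pos_vec (x 0) \<and> norm (x 0) = 1 \<and>
     (\<forall>k. norm (f k) \<le> gam k * sep0 A * min_entry (x k) \<and>
          (lam k *\<^sub>R A - mat 1) *v y (Suc k) = A *v x k + f k \<and>
          x (Suc k) = y (Suc k) /\<^sub>R norm (y (Suc k)) \<and>
          lam (Suc k) = lam k - (1 - gam k) * min_ratio (x k) (y (Suc k)))"

end

theory Submission
  imports Defs "HOL-Computational_Algebra.Polynomial"
begin

text \<open>
  Write \<open>B = A\<^sup>-\<^sup>1 \<ge> 0\<close> and \<open>r = \<rho>(B)\<close>. Multiplied by \<open>B\<close>, the inner system of the iteration reads
  \<open>(\<lambda>\<^sub>k I - B) y\<^sub>k\<^sub>+\<^sub>1 = x\<^sub>k + B f\<^sub>k\<close>, and the residual bound implies that \<open>B f\<^sub>k\<close> is at most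
  \<open>\<gamma>\<^sub>k x\<^sub>k\<close> entrywise in absolute value. So the right-hand side lies between
  \<open>(1 - \<gamma>\<^sub>k) x\<^sub>k\<close> and \<open>(1 + \<gamma>\<^sub>k) x\<^sub>k\<close>. As long as \<open>\<lambda>\<^sub>k > r\<close> this forces \<open>y\<^sub>k\<^sub>+\<^sub>1 > 0\<close>, and the
  update of \<open>\<lambda>\<close> is the largest decrease for which the lower bound still guarantees
  \<open>B y\<^sub>k\<^sub>+\<^sub>1 \<le> \<lambda>\<^sub>k\<^sub>+\<^sub>1 y\<^sub>k\<^sub>+\<^sub>1\<close> (\<open>noda_step\<close>). By the Collatz--Wielandt bound \<open>\<lambda>\<^sub>k\<^sub>+\<^sub>1 \<ge> r\<close>, and equality
  would make \<open>x\<^sub>k\<^sub>+\<^sub>1\<close> the Perron vector (\<open>subinvariant_at_radius\<close>). Hence \<open>\<lambda>\<^sub>k\<close> decreases and stays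
  above \<open>r\<close>.

  Suppose that the limit \<open>L\<close> exceeded \<open>r\<close>. Comparison with a multiple of the Perron vector bounds
  all \<open>y\<^sub>k\<close> from above, because \<open>\<lambda>\<^sub>k I - B\<close> stays uniformly away from singularity. On the other hand
  \<open>B x\<^sub>k \<le> \<lambda>\<^sub>0 x\<^sub>k\<close> for \<open>k \<ge> 1\<close>, and for irreducible \<open>B\<close> all entries of such a vector are comparable,
  with a constant that depends only on \<open>B\<close> and \<open>\<lambda>\<^sub>0\<close> (\<open>harnack\<close>); so the unit vectors \<open>x\<^sub>k\<close> are bounded below
  by a positive constant. Therefore each step from the second one on decreases \<open>\<lambda>\<close> by at least a
  fixed positive amount, which is absurd. Hence \<open>L = r\<close>, and the eigenvalues of \<open>A\<close> are the
  reciprocals of those of \<open>B\<close>, so \<open>r\<^sup>-\<^sup>1 = \<sigma>\<^sub>m\<^sub>i\<^sub>n(A)\<close>.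

  The Perron--Frobenius theory of \<open>B\<close> rests on the operator \<open>v \<mapsto> v + B v\<close>: it enlarges the support of
  every nonnegative vector whose support is neither empty nor full, so that its power of exponent \<open>n\<close>
  is strictly positive. Existence of the Perron vector comes from Brouwer's fixed point theorem.
\<close>

section \<open>Nonnegative and irreducible matrices\<close>

text \<open>Irreducibility without an ordering of the indices: the span of the unit vectors \<open>e\<^sub>j\<close>, \<open>j \<in> J\<close>, is
  invariant under \<open>B\<close> only when \<open>J\<close> is trivial.\<close>

definition coord_irreducible :: "real^'n^'n \<Rightarrow> bool" where
  "coord_irreducible B \<longleftrightarrow>
     (\<forall>J. J \<noteq> {} \<and> J \<noteq> UNIV \<longrightarrow> (\<exists>i. \<exists>j. i \<notin> J \<and> j \<in> J \<and> B $ i $ j \<noteq> 0))"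

lemma mult_vec_nth: "(B *v v) $ i = (\<Sum>j\<in>UNIV. B $ i $ j * v $ j)"
  by (simp add: matrix_vector_mult_def)

lemma nonneg_mult_mono:
  fixes B :: "real^'n^'n"
  assumes "\<And>i j. 0 \<le> B $ i $ j" and "u \<le> v"
  shows "B *v u \<le> B *v v"
  using assms by (auto simp: less_eq_vec_def mult_vec_nth intro!: sum_mono mult_left_mono)

lemma invertible_matrix_inv:
  fixes A :: "real^'n^'n"
  assumes "invertible A"
  shows "A ** matrix_inv A = mat 1" "matrix_inv A ** A = mat 1"
  using someI_ex[OF assms[unfolded invertible_def]] unfolding matrix_inv_def by auto

text \<open>An invariant set \<open>J\<close> yields the block triangular form: list the indices in \<open>J\<close> first.\<close>

lemma irreducible_no_invariant_coords:
  fixes A :: "real^'n^'n"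
  assumes "irreducible_mat A"
  shows "coord_irreducible A"
  unfolding coord_irreducible_def
proof (intro allI impI, rule ccontr)
  fix J :: "'n set"
  assume J: "J \<noteq> {} \<and> J \<noteq> UNIV"
    and none: "\<nexists>i j. i \<notin> J \<and> j \<in> J \<and> A $ i $ j \<noteq> 0"
  let ?r = "card J" and ?n = "CARD('n)"
  have r: "0 < ?r" "?r < ?n"
    using J by (auto simp: card_gt_0_iff intro!: psubset_card_mono)
  obtain h where h: "bij_betw h {..<?r} J"
    using ex_bij_betw_nat_finite[of J] by (auto simp: lessThan_atLeast0)
  have "card {?r..<?n} = card (- J)"
    by (simp add: Compl_eq_Diff_UNIV card_Diff_subset)
  then obtain h' where h': "bij_betw h' {?r..<?n} (- J)"
    using finite_same_card_bij[of "{?r..<?n}" "- J"] by auto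
  define p where "p i = (if i < ?r then h i else h' i)" for i
  have p1: "bij_betw p {..<?r} J"
    using h by (subst bij_betw_cong[of _ _ h]) (auto simp: p_def)
  have p2: "bij_betw p {?r..<?n} (- J)"
    using h' by (subst bij_betw_cong[of _ _ h']) (auto simp: p_def)
  have "bij_betw p ({..<?r} \<union> {?r..<?n}) (J \<union> - J)"
    using p1 p2 by (rule bij_betw_combine) auto
  then have p: "bij_betw p {..<?n} UNIV"
    using r by (simp add: ivl_disj_un)
  have "A $ p i $ p j = 0" if "?r \<le> i" "i < ?n" "j < ?r" for i j
  proof -
    have "p i \<notin> J" "p j \<in> J"
      using p1 p2 that by (auto dest!: bij_betw_imp_surj_on)
    then show ?thesis using none by blast
  qed
  then have "reducible_mat A"
    unfolding reducible_mat_def using p r by blast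
  then show False using assms by (simp add: irreducible_mat_def)
qed

text \<open>A coordinate subspace that is invariant under \<open>A\<^sup>-\<^sup>1\<close> is mapped onto itself, by a dimension count;
  so it is also invariant under \<open>A\<close>.\<close>

lemma coord_irreducible_inverse:
  fixes A :: "real^'n^'n"
  assumes irr: "coord_irreducible A" and inv: "invertible A"
  shows "coord_irreducible (matrix_inv A)"
  unfolding coord_irreducible_def
proof (intro allI impI, rule ccontr)
  fix J :: "'n set"
  let ?B = "matrix_inv A"
  assume J: "J \<noteq> {} \<and> J \<noteq> UNIV"
    and none: "\<nexists>i j. i \<notin> J \<and> j \<in> J \<and> ?B $ i $ j \<noteq> 0"
  define V where "V = {v :: real^'n. \<forall>i. i \<notin> J \<longrightarrow> v $ i = 0}"
  have V: "subspace V"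
    by (auto simp: V_def subspace_def)
  have BA: "?B *v (A *v v) = v" and AB: "A *v (?B *v v) = v" for v
    using invertible_matrix_inv[OF inv] by (simp_all add: matrix_vector_mul_assoc)
  have sub: "(*v) ?B ` V \<subseteq> V"
  proof -
    have "(?B *v v) $ i = 0" if "v \<in> V" "i \<notin> J" for v i
    proof -
      have "?B $ i $ j * v $ j = 0" for j
        using that none by (cases "j \<in> J") (auto simp: V_def)
      then show ?thesis unfolding mult_vec_nth by (rule sum.neutral[OF ballI])
    qed
    then show ?thesis by (auto simp: V_def)
  qed
  have "inj ((*v) ?B)"
    by (rule inj_on_inverseI[of _ "(*v) A"]) (simp add: AB)
  then have "dim ((*v) ?B ` V) = dim V"
    by (intro dim_image_eq) (auto intro: inj_on_subset)
  then have eq: "(*v) ?B ` V = V"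
    using subspace_dim_equal[OF linear_subspace_image[OF _ V] V sub] by simp
  obtain i j where ij: "i \<notin> J" "j \<in> J" "A $ i $ j \<noteq> 0"
    using irr J unfolding coord_irreducible_def by blast
  have "axis j 1 \<in> V" using ij by (auto simp: V_def axis_def)
  then obtain v where v: "v \<in> V" "axis j 1 = ?B *v v" using eq by (metis imageE)
  then have "A *v axis j 1 \<in> V" using AB by simp
  moreover have "(A *v axis j 1) $ i = A $ i $ j"
    by (simp add: mult_vec_nth axis_def if_distrib cong: if_cong)
  ultimately show False using ij by (auto simp: V_def)
qed

text \<open>Powers of \<open>I + B\<close> are used in place of powers of \<open>B\<close>: they commute with \<open>B\<close> and preserve the
  entrywise order just as well, but they never lose support, so periodicity of \<open>B\<close> is harmless.\<close>

definition widen :: "real^'n^'n \<Rightarrow> real^'n \<Rightarrow> real^'n" where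
  "widen B v = v + B *v v"

lemma widen_pow_linear: "linear (widen B ^^ m)"
proof (induction m)
  case 0
  show ?case by (simp add: linear_id[unfolded id_def] id_def)
next
  case (Suc m)
  have "linear (widen B)"
    by (rule linearI) (simp_all add: widen_def algebra_simps)
  then show ?case using linear_compose[OF Suc] by (simp add: o_def)
qed

lemma widen_pow_commute: "(widen B ^^ m) (B *v v) = B *v (widen B ^^ m) v"
  by (induction m) (simp_all add: widen_def algebra_simps)

lemma widen_pow_mono:
  assumes "\<And>i j. 0 \<le> B $ i $ j" and "u \<le> v"
  shows "(widen B ^^ m) u \<le> (widen B ^^ m) v"
proof (induction m)
  case 0
  show ?case using assms by simp
next
  case (Suc m)
  show ?case
    using Suc nonneg_mult_mono[OF assms(1) Suc]
    by (auto simp: widen_def less_eq_vec_def intro: add_mono)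
qed

lemma widen_pow_nonneg:
  assumes "\<And>i j. 0 \<le> B $ i $ j" and "0 \<le> v"
  shows "0 \<le> (widen B ^^ m) v"
  using widen_pow_mono[OF assms, of m] linear_0[OF widen_pow_linear[of m B]] by simp

text \<open>Irreducibility gives an index outside the current support that is fed from inside it, so each
  application of \<open>I + B\<close> adds at least one index until the support is full.\<close>

lemma widen_pow_pos:
  fixes B :: "real^'n^'n"
  assumes nn: "\<And>i j. 0 \<le> B $ i $ j" and irr: "coord_irreducible B"
    and v: "0 \<le> v" "v \<noteq> 0"
  shows "pos_vec ((widen B ^^ CARD('n)) v)"
proof -
  define S where "S m = {i. 0 < (widen B ^^ m) v $ i}" for m
  have grow: "min (Suc m) CARD('n) \<le> card (S m)" for m
  proof (induction m)
    case 0
    obtain i where "v $ i \<noteq> 0" using v by (auto simp: vec_eq_iff)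
    then have "i \<in> S 0"
      using v by (auto simp: S_def less_eq_vec_def order_less_le)
    then have "0 < card (S 0)" by (auto simp: card_gt_0_iff)
    then show ?case by simp
  next
    case (Suc m)
    let ?w = "(widen B ^^ m) v"
    have w: "0 \<le> ?w" using widen_pow_nonneg[OF nn v(1)] .
    then have Bw: "0 \<le> (B *v ?w) $ i" for i
      using nonneg_mult_mono[OF nn w] by (simp add: less_eq_vec_def)
    have sub: "S m \<subseteq> S (Suc m)"
      using Bw by (auto simp: S_def widen_def add_pos_nonneg)
    show ?case
    proof (cases "S m = UNIV")
      case True
      then have "S (Suc m) = UNIV" using sub by auto
      then show ?thesis by simp
    next
      case False
      have "0 < min (Suc m) CARD('n)" by simp
      then have "0 < card (S m)" using Suc by (rule less_le_trans)
      then have "S m \<noteq> {}" by auto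
      then obtain i j where ij: "i \<notin> S m" "j \<in> S m" "B $ i $ j \<noteq> 0"
        using irr False unfolding coord_irreducible_def by blast
      have "0 < B $ i $ j * ?w $ j"
        using ij nn[of i j] by (auto simp: S_def intro!: mult_pos_pos)
      also have "\<dots> \<le> (B *v ?w) $ i"
        unfolding mult_vec_nth using nn w
        by (intro member_le_sum) (auto simp: less_eq_vec_def)
      finally have "i \<in> S (Suc m)"
        using w by (auto simp: S_def widen_def less_eq_vec_def add_nonneg_pos)
      then have "S m \<subset> S (Suc m)" using sub ij by blast
      then have "card (S m) < card (S (Suc m))" by (intro psubset_card_mono) auto
      then show ?thesis using Suc by linarith
    qed
  qed
  have "CARD('n) \<le> card (S CARD('n))" using grow[of "CARD('n)"] by simp
  then have "S CARD('n) = UNIV" by (intro card_seteq) auto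
  then show ?thesis by (auto simp: pos_vec_def S_def)
qed

text \<open>A Harnack inequality. If \<open>T = (I + B)\<^sup>n\<close> then \<open>T v \<le> (1 + c)\<^sup>n v\<close>, while \<open>v \<ge> v\<^sub>j e\<^sub>j\<close> gives
  \<open>T v \<ge> v\<^sub>j T e\<^sub>j\<close>, whose entries are at least \<open>e v\<^sub>j\<close> for the smallest entry \<open>e > 0\<close> of \<open>T\<close>. The
  constant is independent of \<open>v\<close>, which is what keeps the Noda iterates away from the boundary
  of the positive cone.\<close>

lemma harnack:
  fixes B :: "real^'n^'n"
  assumes nn: "\<And>i j. 0 \<le> B $ i $ j" and irr: "coord_irreducible B" and c: "0 \<le> c"
  obtains d where "0 < d"
    and "\<And>v i j. 0 \<le> v \<Longrightarrow> B *v v \<le> c *\<^sub>R v \<Longrightarrow> d * v $ j \<le> v $ i"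
proof -
  let ?T = "widen B ^^ CARD('n)"
  define e where "e = Min (range (\<lambda>(i, j). ?T (axis j 1) $ i))"
  have "0 < ?T (axis j 1) $ i" for i j
  proof -
    have "0 \<le> (axis j 1 :: real^'n)" by (auto simp: less_eq_vec_def axis_def)
    then show ?thesis
      using widen_pow_pos[OF nn irr, of "axis j 1"] by (auto simp: pos_vec_def axis_eq_0_iff)
  qed
  then have e: "0 < e" by (auto simp: e_def)
  have e_le: "e \<le> ?T (axis j 1) $ i" for i j
    unfolding e_def by (rule Min_le) (auto intro!: rev_image_eqI[of "(i, j)"])
  have main: "e / (1 + c) ^ CARD('n) * v $ j \<le> v $ i"
    if v: "0 \<le> v" and Bv: "B *v v \<le> c *\<^sub>R v" for v i j
  proof -
    have up: "(widen B ^^ m) v \<le> (1 + c) ^ m *\<^sub>R v" for m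
    proof (induction m)
      case (Suc m)
      have "widen B ((widen B ^^ m) v) \<le> widen B ((1 + c) ^ m *\<^sub>R v)"
        using widen_pow_mono[OF nn Suc, of 1] by simp
      also have "\<dots> = (1 + c) ^ m *\<^sub>R (v + B *v v)"
        by (simp add: widen_def matrix_vector_mult_scaleR algebra_simps)
      also have "\<dots> \<le> (1 + c) ^ m *\<^sub>R ((1 + c) *\<^sub>R v)"
        using Bv c by (auto simp: less_eq_vec_def algebra_simps intro!: mult_left_mono)
      finally show ?case by (simp add: mult.commute)
    qed simp
    have vj: "0 \<le> v $ j" using v by (simp add: less_eq_vec_def)
    have "v $ j *\<^sub>R axis j 1 \<le> v" using v by (auto simp: less_eq_vec_def axis_def)
    from widen_pow_mono[OF nn this, of "CARD('n)"]
    have "v $ j *\<^sub>R ?T (axis j 1) \<le> ?T v"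
      by (simp add: linear_scale[OF widen_pow_linear])
    then have "v $ j * ?T (axis j 1) $ i \<le> ?T v $ i" by (simp add: less_eq_vec_def)
    moreover have "v $ j * e \<le> v $ j * ?T (axis j 1) $ i"
      using vj e_le by (rule mult_left_mono[rotated])
    moreover have "?T v $ i \<le> (1 + c) ^ CARD('n) * v $ i"
      using up by (simp add: less_eq_vec_def)
    ultimately show ?thesis using c by (simp add: field_simps)
  qed
  show thesis
    by (rule that[OF _ main]) (use e c in auto)
qed

lemma subinvariant_pos:
  fixes B :: "real^'n^'n"
  assumes nn: "\<And>i j. 0 \<le> B $ i $ j" and irr: "coord_irreducible B" and c: "0 \<le> c"
    and v: "0 \<le> v" "v \<noteq> 0" "B *v v \<le> c *\<^sub>R v"
  shows "pos_vec v"
  unfolding pos_vec_def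
proof
  fix i
  obtain d where d: "0 < d" "\<And>i j. d * v $ j \<le> v $ i"
    using harnack[OF nn irr c] v by metis
  obtain j where "v $ j \<noteq> 0" using v by (auto simp: vec_eq_iff)
  then have "0 < v $ j" using v by (auto simp: less_eq_vec_def order_less_le)
  then have "0 < d * v $ j" using d by simp
  then show "0 < v $ i" using d(2)[of j i] by linarith
qed

section \<open>Perron--Frobenius theory\<close>

lemma min_ratio_attained:
  fixes w v :: "real^'n"
  obtains i where "min_ratio w v = w $ i / v $ i"
proof -
  have "min_ratio w v \<in> range (\<lambda>i. w $ i / v $ i)"
    unfolding min_ratio_def by (rule Min_in) auto
  then show thesis using that by blast
qed

lemma min_ratio_le: "min_ratio w v \<le> w $ i / v $ i"
  unfolding min_ratio_def by (rule Min_le) auto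

text \<open>Look at the index where \<open>|w\<^sub>i| / z\<^sub>i\<close> is maximal for an eigenvector \<open>w\<close>: this is the operator norm
  bound for the maximum norm with weights \<open>z\<close>.\<close>

lemma collatz_wielandt_bound:
  fixes B :: "real^'n^'n"
  assumes nn: "\<And>i j. 0 \<le> B $ i $ j" and z: "pos_vec z" and Bz: "B *v z \<le> c *\<^sub>R z"
    and mu: "\<mu> \<in> mat_spectrum B"
  shows "cmod \<mu> \<le> c"
proof -
  obtain w where w: "w \<noteq> 0" "(\<chi> i j. complex_of_real (B $ i $ j)) *v w = \<mu> *s w"
    using mu unfolding mat_spectrum_def by blast
  define t where "t = Max (range (\<lambda>i. cmod (w $ i) / z $ i))"
  obtain i where i: "t = cmod (w $ i) / z $ i"
  proof -
    have "t \<in> range (\<lambda>i. cmod (w $ i) / z $ i)"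
      unfolding t_def by (rule Max_in) auto
    then show thesis using that by blast
  qed
  have zp: "0 < z $ j" for j using z by (simp add: pos_vec_def)
  have le: "cmod (w $ j) \<le> t * z $ j" for j
  proof -
    have "cmod (w $ j) / z $ j \<le> t" unfolding t_def by (rule Max_ge) auto
    then show ?thesis using zp[of j] by (simp add: field_simps)
  qed
  obtain j where "w $ j \<noteq> 0" using w by (auto simp: vec_eq_iff)
  then have "0 < t * z $ j" using le[of j] by (meson less_le_trans zero_less_norm_iff)
  then have t: "0 < t" using zp[of j] by (simp add: zero_less_mult_iff)
  have wi: "cmod (w $ i) = t * z $ i" using i zp[of i] by simp
  have "cmod \<mu> * (t * z $ i) = cmod ((\<mu> *s w) $ i)" by (simp add: norm_mult wi)
  also have "\<dots> = cmod (\<Sum>j\<in>UNIV. complex_of_real (B $ i $ j) * w $ j)"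
    unfolding w(2)[symmetric] by (simp add: matrix_vector_mult_def)
  also have "\<dots> \<le> (\<Sum>j\<in>UNIV. B $ i $ j * cmod (w $ j))"
    by (rule order_trans[OF norm_sum]) (simp add: norm_mult nn)
  also have "\<dots> \<le> (\<Sum>j\<in>UNIV. B $ i $ j * (t * z $ j))"
    by (intro sum_mono mult_left_mono le nn)
  also have "\<dots> = t * (B *v z) $ i"
    by (simp add: mult_vec_nth sum_distrib_left algebra_simps)
  also have "\<dots> \<le> t * (c * z $ i)"
    using Bz t by (simp add: less_eq_vec_def)
  finally show ?thesis using t zp[of i] by (simp add: mult.left_commute)
qed

text \<open>The eigenvalues are the roots of the characteristic polynomial, built here as a determinant over
  the ring of polynomials. A number that is not an eigenvalue shows that the polynomial is nonzero.
  Finiteness is what gives the maximum in the spectral radius its meaning.\<close>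

lemma finite_mat_spectrum:
  fixes B :: "real^'n^'n"
  assumes "\<mu>\<^sub>0 \<notin> mat_spectrum B"
  shows "finite (mat_spectrum B)"
proof -
  let ?C = "\<chi> i j. complex_of_real (B $ i $ j)"
  define P where "P = (\<chi> i j. [:?C $ i $ j:] - (if i = j then [:0, 1:] else 0))"
  have poly: "poly (det P) \<mu> = det (?C - mat \<mu>)" for \<mu>
    unfolding det_def P_def
    by (simp add: poly_sum poly_prod mat_def if_distrib[of "\<lambda>p. poly p \<mu>"] cong: if_cong)
  have root: "\<mu> \<in> mat_spectrum B \<longleftrightarrow> poly (det P) \<mu> = 0" for \<mu>
  proof -
    have "mat \<mu> *v v = \<mu> *s v" for v :: "complex^'n"
      by (auto simp: vec_eq_iff matrix_vector_mult_def mat_def if_distrib[of "\<lambda>x. x * _"]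
          cong: if_cong)
    then have "(?C - mat \<mu>) *v v = ?C *v v - \<mu> *s v" for v
      by (simp add: matrix_vector_mult_diff_rdistrib)
    then have "\<mu> \<in> mat_spectrum B \<longleftrightarrow> (\<exists>v. v \<noteq> 0 \<and> (?C - mat \<mu>) *v v = 0)"
      unfolding mat_spectrum_def by simp
    also have "\<dots> \<longleftrightarrow> \<not> invertible (?C - mat \<mu>)"
      unfolding invertible_left_inverse matrix_left_invertible_ker by blast
    also have "\<dots> \<longleftrightarrow> poly (det P) \<mu> = 0"
      by (simp add: poly invertible_det_nz)
    finally show ?thesis .
  qed
  have "det P \<noteq> 0" using assms root by (metis poly_0)
  then have "finite {\<mu>. poly (det P) \<mu> = 0}" by (rule poly_roots_finite)
  moreover have "mat_spectrum B = {\<mu>. poly (det P) \<mu> = 0}" using root by blast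
  ultimately show ?thesis by simp
qed

text \<open>Brouwer's theorem for \<open>v \<mapsto> B v / \<Sigma>\<^sub>i (B v)\<^sub>i\<close> on the standard simplex. The map is well defined because
  \<open>B v = 0\<close> would make all columns in the support of \<open>v\<close> vanish, and then that support would be an
  invariant set of indices.\<close>

lemma perron_pair_exists:
  fixes B :: "real^'n^'n"
  assumes nn: "\<And>i j. 0 \<le> B $ i $ j" and irr: "coord_irreducible B" and B0: "B \<noteq> 0"
  obtains v r where "pos_vec v" "0 < r" "B *v v = r *\<^sub>R v"
proof -
  define S where "S = {v :: real^'n. 0 \<le> v \<and> (\<Sum>i\<in>UNIV. v $ i) = 1}"
  define s where "s v = (\<Sum>i\<in>UNIV. (B *v v) $ i)" for v
  have nz: "B *v v \<noteq> 0" if v: "v \<in> S" for v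
  proof
    assume Bv: "B *v v = 0"
    let ?J = "{j. v $ j \<noteq> 0}"
    have zero: "B $ i $ j = 0" if "j \<in> ?J" for i j
    proof -
      have "(\<Sum>j\<in>UNIV. B $ i $ j * v $ j) = 0"
        using Bv by (simp add: mult_vec_nth[symmetric])
      then have "B $ i $ j * v $ j = 0"
        using nn v by (subst (asm) sum_nonneg_eq_0_iff) (auto simp: S_def less_eq_vec_def)
      then show ?thesis using that by simp
    qed
    have "v \<noteq> 0" using v by (auto simp: S_def)
    then have "?J \<noteq> {}" by (auto simp: vec_eq_iff)
    moreover have "?J \<noteq> UNIV" using zero B0 by (auto simp: vec_eq_iff)
    ultimately have "\<exists>i j. i \<notin> ?J \<and> j \<in> ?J \<and> B $ i $ j \<noteq> 0"
      using irr[unfolded coord_irreducible_def, rule_format, of ?J] by simp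
    then show False using zero by metis
  qed
  have Bv: "0 \<le> B *v v" if "v \<in> S" for v
    using nonneg_mult_mono[OF nn, of 0 v] that by (simp add: S_def)
  have s: "0 < s v" if "v \<in> S" for v
  proof -
    have "\<exists>i. (B *v v) $ i \<noteq> 0" using nz[OF that] by (simp add: vec_eq_iff)
    then obtain i where "(B *v v) $ i \<noteq> 0" ..
    then show ?thesis
      unfolding s_def using Bv[OF that]
      by (intro sum_pos2[of _ i]) (auto simp: less_eq_vec_def order_less_le)
  qed
  have comp: "compact S"
  proof -
    have "v $ i \<le> 1" if "v \<in> S" for v i
      using that member_le_sum[of i UNIV "\<lambda>i. v $ i"] by (auto simp: S_def less_eq_vec_def)
    then have "S = cbox 0 1 \<inter> {v. (\<Sum>i\<in>UNIV. v $ i) = 1}"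
      by (auto simp: interval_cart S_def less_eq_vec_def)
    moreover have "closed {v :: real^'n. (\<Sum>i\<in>UNIV. v $ i) = 1}"
      by (intro closed_Collect_eq continuous_intros)
    ultimately show ?thesis by (simp add: compact_Int_closed)
  qed
  have conv: "convex S"
    by (rule convexI)
      (auto simp: S_def less_eq_vec_def sum.distrib sum_distrib_left[symmetric])
  have ne: "S \<noteq> {}"
    by (auto simp: S_def less_eq_vec_def axis_def intro!: exI[of _ "axis undefined 1"])
  have cont: "continuous_on S (\<lambda>v. (1 / s v) *\<^sub>R (B *v v))"
    unfolding s_def using s[unfolded s_def]
    by (intro continuous_intros) (auto simp: less_le)
  have maps: "(1 / s v) *\<^sub>R (B *v v) \<in> S" if "v \<in> S" for v
  proof -
    have "0 \<le> ((1 / s v) *\<^sub>R (B *v v)) $ i" for i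
      using s[OF that] Bv[OF that] by (simp add: less_eq_vec_def)
    moreover have "(\<Sum>i\<in>UNIV. ((1 / s v) *\<^sub>R (B *v v)) $ i) = (1 / s v) * s v"
      by (simp add: s_def sum_divide_distrib[symmetric])
    ultimately show ?thesis using s[OF that] by (simp add: S_def less_eq_vec_def)
  qed
  obtain v where v: "v \<in> S" "(1 / s v) *\<^sub>R (B *v v) = v"
    using brouwer[OF comp conv ne cont] maps by blast
  have eig: "B *v v = s v *\<^sub>R v"
    using s[OF v(1)] arg_cong[OF v(2), of "\<lambda>u. s v *\<^sub>R u"] by simp
  have "v \<noteq> 0" using v(1) by (auto simp: S_def)
  then have "pos_vec v"
    using subinvariant_pos[OF nn irr, of "s v" v] eig s[OF v(1)] v(1) by (auto simp: S_def)
  then show thesis using that s[OF v(1)] eig by blast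
qed

lemma real_eigenvalue_in_spectrum:
  fixes B :: "real^'n^'n"
  assumes "B *v v = r *\<^sub>R v" "v \<noteq> 0"
  shows "complex_of_real r \<in> mat_spectrum B"
proof -
  have "(\<chi> i j. complex_of_real (B $ i $ j)) *v (\<chi> i. complex_of_real (v $ i))
      = complex_of_real r *s (\<chi> i. complex_of_real (v $ i))"
    using assms(1)
    by (auto simp: vec_eq_iff matrix_vector_mult_def simp flip: of_real_mult of_real_sum)
  moreover have "(\<chi> i. complex_of_real (v $ i)) \<noteq> 0" using assms(2) by (auto simp: vec_eq_iff)
  ultimately show ?thesis unfolding mat_spectrum_def by blast
qed

lemma perron_frobenius:
  fixes B :: "real^'n^'n"
  assumes nn: "\<And>i j. 0 \<le> B $ i $ j" and irr: "coord_irreducible B" and B0: "B \<noteq> 0"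
  shows "finite (mat_spectrum B)" "mat_spectrum B \<noteq> {}" "0 < spec_radius B"
    and "\<exists>v. pos_vec v \<and> norm v = 1 \<and> B *v v = spec_radius B *\<^sub>R v"
proof -
  obtain v r where v: "pos_vec v" and r: "0 < r" and eig: "B *v v = r *\<^sub>R v"
    using perron_pair_exists[OF assms] .
  have bound: "cmod \<mu> \<le> r" if "\<mu> \<in> mat_spectrum B" for \<mu>
    using collatz_wielandt_bound[OF nn v _ that] eig by simp
  have "complex_of_real (r + 1) \<notin> mat_spectrum B"
    using bound[of "complex_of_real (r + 1)"] r by auto
  then show fin: "finite (mat_spectrum B)" by (rule finite_mat_spectrum)
  have v0: "v \<noteq> 0" using v by (auto simp: pos_vec_def)
  then have mem: "complex_of_real r \<in> mat_spectrum B"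
    using real_eigenvalue_in_spectrum eig by blast
  then show "mat_spectrum B \<noteq> {}" by blast
  have rad: "spec_radius B = r"
    unfolding spec_radius_def
    using fin bound mem r by (intro Max_eqI) (auto intro!: rev_image_eqI[OF mem])
  then show "0 < spec_radius B" using r by simp
  show "\<exists>v. pos_vec v \<and> norm v = 1 \<and> B *v v = spec_radius B *\<^sub>R v"
    using v v0 eig rad
    by (intro exI[of _ "v /\<^sub>R norm v"]) (auto simp: pos_vec_def matrix_vector_mult_scaleR)
qed

text \<open>The largest multiple of \<open>v\<close> below \<open>u\<close> touches \<open>u\<close> at some index.\<close>

lemma comparison_min_ratio:
  fixes u v :: "real^'n"
  assumes "pos_vec v"
  obtains i where "min_ratio u v *\<^sub>R v \<le> u" "u $ i = min_ratio u v * v $ i"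
proof -
  have v: "0 < v $ i" for i using assms by (simp add: pos_vec_def)
  obtain i where i: "min_ratio u v = u $ i / v $ i" by (rule min_ratio_attained)
  show thesis
  proof (rule that)
    show "min_ratio u v *\<^sub>R v \<le> u"
      unfolding less_eq_vec_def
    proof
      fix j
      show "(min_ratio u v *\<^sub>R v) $ j \<le> u $ j"
        using min_ratio_le[of u v j] v[of j] by (simp add: field_simps)
    qed
    show "u $ i = min_ratio u v * v $ i" using i v[of i] by simp
  qed
qed

text \<open>Subtract from \<open>u\<close> the largest multiple of \<open>v\<close> below it. The difference is a nonnegative eigenvector
  with a zero entry, and a nonzero one would be positive.\<close>

lemma positive_eigenvector_unique:
  fixes B :: "real^'n^'n"
  assumes nn: "\<And>i j. 0 \<le> B $ i $ j" and irr: "coord_irreducible B" and r: "0 \<le> r"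
    and u: "pos_vec u" "norm u = 1" "B *v u = r *\<^sub>R u"
    and v: "pos_vec v" "norm v = 1" "B *v v = r *\<^sub>R v"
  shows "u = v"
proof -
  define t where "t = min_ratio u v"
  obtain i where i: "t *\<^sub>R v \<le> u" "u $ i = t * v $ i"
    unfolding t_def by (rule comparison_min_ratio[OF v(1)])
  define w where "w = u - t *\<^sub>R v"
  have w: "0 \<le> w" using i by (auto simp: w_def less_eq_vec_def)
  have "B *v w = r *\<^sub>R w"
    by (simp add: w_def algebra_simps u v)
  moreover have "\<not> pos_vec w" using i(2) by (auto simp: w_def pos_vec_def intro!: exI[of _ i])
  ultimately have "w = 0" using subinvariant_pos[OF nn irr r w] by fastforce
  then have uv: "u = t *\<^sub>R v" by (simp add: w_def)
  moreover have "0 < t"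
  proof -
    have "0 < t * v $ i" "0 < v $ i"
      using u(1) v(1) unfolding i(2)[symmetric] by (auto simp: pos_vec_def)
    then show ?thesis by (simp add: zero_less_mult_iff)
  qed
  ultimately have "norm u = t * norm v" by simp
  then show ?thesis using uv u v by simp
qed

lemma perron_vec_eqI:
  fixes B :: "real^'n^'n"
  assumes nn: "\<And>i j. 0 \<le> B $ i $ j" and irr: "coord_irreducible B" and B0: "B \<noteq> 0"
    and u: "pos_vec u" "norm u = 1" "B *v u = spec_radius B *\<^sub>R u"
  shows "u = perron_vec B"
proof -
  have r: "0 \<le> spec_radius B" using perron_frobenius(3)[OF nn irr B0] by simp
  show ?thesis
    unfolding perron_vec_def
    by (rule the_equality[symmetric])
      (use u positive_eigenvector_unique[OF nn irr r] in auto)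
qed

text \<open>A maximum principle for \<open>l I - B\<close>: at the index where \<open>y / v\<close> is minimal,
  \<open>(B y)\<^sub>i \<ge> r y\<^sub>i\<close>, hence \<open>(l - r) y\<^sub>i \<ge> 0\<close>, and the minimal ratio is nonnegative.\<close>

lemma shifted_inverse_nonneg:
  fixes B :: "real^'n^'n"
  assumes nn: "\<And>i j. 0 \<le> B $ i $ j" and v: "pos_vec v" "B *v v = r *\<^sub>R v"
    and l: "r < l" and w: "0 \<le> l *\<^sub>R y - B *v y"
  shows "0 \<le> y"
proof -
  obtain i where i: "min_ratio y v *\<^sub>R v \<le> y" "y $ i = min_ratio y v * v $ i"
    by (rule comparison_min_ratio[OF v(1)])
  have vp: "0 < v $ j" for j using v by (simp add: pos_vec_def)
  have "r * y $ i = (B *v (min_ratio y v *\<^sub>R v)) $ i"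
    using i(2) by (simp add: matrix_vector_mult_scaleR v)
  also have "\<dots> \<le> (B *v y) $ i"
    using nonneg_mult_mono[OF nn i(1)] by (simp add: less_eq_vec_def)
  also have "\<dots> \<le> l * y $ i" using w by (simp add: less_eq_vec_def)
  finally have "0 \<le> (l - r) * y $ i" by (simp add: algebra_simps)
  then have "0 \<le> y $ i" using l by (simp add: zero_le_mult_iff)
  then have "0 \<le> min_ratio y v" using i(2) vp[of i] by (simp add: zero_le_mult_iff)
  then have "0 \<le> (min_ratio y v *\<^sub>R v) $ j" for j using vp[of j] by simp
  then show ?thesis using i(1) by (fastforce simp: less_eq_vec_def intro: order_trans)
qed

lemma strict_collatz_wielandt:
  fixes B :: "real^'n^'n"
  assumes nn: "\<And>i j. 0 \<le> B $ i $ j" and z: "pos_vec z"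
    and Bz: "pos_vec (r *\<^sub>R z - B *v z)" and mu: "\<mu> \<in> mat_spectrum B"
  shows "cmod \<mu> < r"
proof -
  define e where "e = min_ratio (r *\<^sub>R z - B *v z) z"
  obtain i where i: "e *\<^sub>R z \<le> r *\<^sub>R z - B *v z" "(r *\<^sub>R z - B *v z) $ i = e * z $ i"
    unfolding e_def by (rule comparison_min_ratio[OF z])
  have "0 < e * z $ i" "0 < z $ i" using Bz z unfolding i(2)[symmetric] pos_vec_def by auto
  then have "0 < e" by (simp add: zero_less_mult_iff)
  moreover have "B *v z \<le> (r - e) *\<^sub>R z"
    using i(1) by (simp add: less_eq_vec_def algebra_simps)
  then have "cmod \<mu> \<le> r - e" using collatz_wielandt_bound[OF nn z _ mu] by blast
  ultimately show ?thesis by simp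
qed

text \<open>If \<open>B z \<le> c z\<close> were not an equality, then applying \<open>(I + B)\<^sup>n\<close>, which commutes with \<open>B\<close>, would make
  the inequality strict in every entry, and the spectral radius would be smaller than \<open>c\<close>.\<close>

lemma subinvariant_at_radius:
  fixes B :: "real^'n^'n"
  assumes nn: "\<And>i j. 0 \<le> B $ i $ j" and irr: "coord_irreducible B" and B0: "B \<noteq> 0"
    and z: "pos_vec z" and c: "B *v z \<le> c *\<^sub>R z"
  shows "spec_radius B \<le> c" 
    and "c = spec_radius B \<Longrightarrow> B *v z = c *\<^sub>R z"
proof -
  note pf = perron_frobenius[OF nn irr B0]
  have "spec_radius B \<in> cmod ` mat_spectrum B"
    unfolding spec_radius_def using pf by (intro Max_in) auto
  then obtain \<mu> where mu: "\<mu> \<in> mat_spectrum B" "cmod \<mu> = spec_radius B" by auto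
  show "spec_radius B \<le> c" using collatz_wielandt_bound[OF nn z c mu(1)] mu(2) by simp
  assume ceq: "c = spec_radius B"
  show "B *v z = c *\<^sub>R z"
  proof (rule ccontr)
    let ?T = "widen B ^^ CARD('n)"
    define w where "w = c *\<^sub>R z - B *v z"
    assume "B *v z \<noteq> c *\<^sub>R z"
    then have w: "w \<noteq> 0" "0 \<le> w" using c by (auto simp: w_def less_eq_vec_def)
    have "pos_vec (?T w)" using widen_pow_pos[OF nn irr w(2,1)] .
    then have "pos_vec (c *\<^sub>R ?T z - B *v ?T z)"
      by (simp add: w_def linear_diff[OF widen_pow_linear] linear_scale[OF widen_pow_linear]
          widen_pow_commute)
    moreover have "0 \<le> z" "z \<noteq> 0"
      using z by (auto simp: pos_vec_def less_eq_vec_def less_imp_le)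
    then have "pos_vec (?T z)" by (rule widen_pow_pos[OF nn irr])
    ultimately have "cmod \<mu> < c" using strict_collatz_wielandt[OF nn _ _ mu(1)] by blast
    then show False using mu(2) ceq by simp
  qed
qed

text \<open>Applied to \<open>(A, A\<^sup>-\<^sup>1)\<close> and to \<open>(A\<^sup>-\<^sup>1, A)\<close>, this gives the two inclusions between the spectrum of \<open>A\<close>
  and the reciprocals of the spectrum of \<open>A\<^sup>-\<^sup>1\<close>.\<close>

lemma left_inverse_spectrum:
  fixes M N :: "real^'n^'n"
  assumes NM: "N ** M = mat 1" and mu: "\<mu> \<in> mat_spectrum M"
  shows "\<mu> \<noteq> 0" and "inverse \<mu> \<in> mat_spectrum N"
proof -
  let ?N = "\<chi> i j. complex_of_real (N $ i $ j)" and ?M = "\<chi> i j. complex_of_real (M $ i $ j)"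
  obtain v where v: "v \<noteq> 0" "?M *v v = \<mu> *s v" using mu by (auto simp: mat_spectrum_def)
  have "?N ** ?M = (\<chi> i j. complex_of_real ((N ** M) $ i $ j))"
    by (simp add: vec_eq_iff matrix_matrix_mult_def)
  also have "\<dots> = mat 1" by (simp add: NM vec_eq_iff mat_def)
  finally have "v = ?N *v (?M *v v)" by (simp add: matrix_vector_mul_assoc)
  also have "\<dots> = \<mu> *s (?N *v v)" by (simp add: v(2) vector_scalar_commute)
  finally have eq: "v = \<mu> *s (?N *v v)" .
  then show nz: "\<mu> \<noteq> 0" using v(1) by auto
  have "inverse \<mu> *s v = inverse \<mu> *s (\<mu> *s (?N *v v))" using eq by simp
  then have "?N *v v = inverse \<mu> *s v" using nz by (simp add: vector_smult_assoc)
  then show "inverse \<mu> \<in> mat_spectrum N" using v(1) by (auto simp: mat_spectrum_def)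
qed

lemma sigma_min_eq_inverse_spec_radius:
  fixes A :: "real^'n^'n"
  assumes inv: "invertible A"
    and fin: "finite (mat_spectrum (matrix_inv A))" and ne: "mat_spectrum (matrix_inv A) \<noteq> {}"
    and pos: "0 < spec_radius (matrix_inv A)"
  shows "sigma_min A = inverse (spec_radius (matrix_inv A))"
proof -
  let ?M = "mat_spectrum (matrix_inv A)" and ?r = "spec_radius (matrix_inv A)"
  note BA = invertible_matrix_inv[OF inv]
  have nz: "\<mu> \<noteq> 0" if "\<mu> \<in> ?M" for \<mu>
    using left_inverse_spectrum(1)[OF BA(1) that] .
  have A: "mat_spectrum A = inverse ` ?M"
  proof
    show "mat_spectrum A \<subseteq> inverse ` ?M"
    proof
      fix \<mu> assume "\<mu> \<in> mat_spectrum A"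
      then have "inverse \<mu> \<in> ?M" by (rule left_inverse_spectrum(2)[OF BA(2)])
      then show "\<mu> \<in> inverse ` ?M" by (rule rev_image_eqI) simp
    qed
    show "inverse ` ?M \<subseteq> mat_spectrum A"
      using left_inverse_spectrum(2)[OF BA(1)] by blast
  qed
  have "?r \<in> cmod ` ?M" unfolding spec_radius_def using fin ne by (intro Max_in) auto
  then obtain \<mu> where mu: "\<mu> \<in> ?M" "?r = cmod \<mu>" by blast
  have le: "cmod \<nu> \<le> ?r" if "\<nu> \<in> ?M" for \<nu>
    unfolding spec_radius_def using fin that by (intro Max_ge) auto
  show ?thesis
    unfolding sigma_min_def A
  proof (rule Min_eqI)
    show "finite (cmod ` inverse ` ?M)" using fin by simp
    show "inverse ?r \<le> y" if "y \<in> cmod ` inverse ` ?M" for y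
      using that le nz by (auto simp: norm_inverse intro!: le_imp_inverse_le)
    show "inverse ?r \<in> cmod ` inverse ` ?M"
      unfolding mu(2) norm_inverse[symmetric] using mu(1) by (intro imageI)
  qed
qed

section \<open>The inexact Noda iteration\<close>

text \<open>Since \<open>sep(0, A)\<close> is the reciprocal of the norm of \<open>A\<^sup>-\<^sup>1\<close>, the tolerance on \<open>f\<close> becomes a bound on
  \<open>A\<^sup>-\<^sup>1 f\<close> by a multiple of the smallest entry of \<open>x\<close>, so it is a relative bound in each entry.\<close>

lemma perturbation_bound:
  fixes A :: "real^'n^'n"
  assumes inv: "invertible A" and x: "pos_vec x" and g: "0 \<le> g"
    and f: "norm f \<le> g * sep0 A * min_entry x"
  shows "\<bar>(matrix_inv A *v f) $ i\<bar> \<le> g * x $ i"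
proof -
  let ?B = "matrix_inv A" and ?N = "onorm ((*v) (matrix_inv A))"
  have N: "0 \<le> ?N" by (rule onorm_pos_le) simp
  have m: "min_entry x \<le> x $ i" unfolding min_entry_def by (rule Min_le) auto
  have "min_entry x \<in> range (\<lambda>i. x $ i)" unfolding min_entry_def by (rule Min_in) auto
  then have m0: "0 \<le> min_entry x" using x by (auto simp: pos_vec_def less_imp_le)
  have "\<bar>(?B *v f) $ i\<bar> \<le> norm (?B *v f)" by (rule component_le_norm_cart)
  also have "\<dots> \<le> ?N * norm f" by (rule onorm) simp
  also have "\<dots> \<le> ?N * (g * inverse ?N * min_entry x)"
    using f N by (intro mult_left_mono) (simp_all add: sep0_def)
  also have "\<dots> \<le> g * min_entry x"
    using m0 g by (cases "?N = 0") (simp_all add: field_simps)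
  also have "\<dots> \<le> g * x $ i" using m g by (rule mult_left_mono)
  finally show ?thesis .
qed

text \<open>One step, seen through \<open>l y - B y = x + B f\<close>. The bound \<open>x + B f \<ge> (1 - g) x\<close> gives positivity of \<open>y\<close>
  and, divided by \<open>y\<close>, the sub-invariance at the updated shift; the bound \<open>x + B f \<le> (1 + g) x\<close>
  serves to bound \<open>y\<close> from above.\<close>

lemma noda_step:
  fixes A :: "real^'n^'n"
  assumes irr: "coord_irreducible (matrix_inv A)" and inv: "invertible A"
    and nn: "\<And>i j. 0 \<le> matrix_inv A $ i $ j" and B0: "matrix_inv A \<noteq> 0"
    and x: "pos_vec x" and l: "spec_radius (matrix_inv A) < l" and g: "0 \<le> g" "g < 1"
    and f: "norm f \<le> g * sep0 A * min_entry x"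
    and y: "(l *\<^sub>R A - mat 1) *v y = A *v x + f"
  defines "l' \<equiv> l - (1 - g) * min_ratio x y"
  shows "pos_vec y" and "matrix_inv A *v y \<le> l' *\<^sub>R y" and "l' < l"
    and "l *\<^sub>R y - matrix_inv A *v y \<le> (1 + g) *\<^sub>R x"
proof -
  let ?B = "matrix_inv A"
  have BA: "?B *v (A *v u) = u" for u
    using invertible_matrix_inv[OF inv] by (simp add: matrix_vector_mul_assoc)
  have "?B *v ((l *\<^sub>R A - mat 1) *v y) = l *\<^sub>R y - ?B *v y"
    by (simp add: matrix_vector_mult_diff_rdistrib matrix_vector_mult_diff_distrib
        scaleR_matrix_vector_assoc[symmetric] matrix_vector_mult_scaleR BA)
  moreover have "?B *v ((l *\<^sub>R A - mat 1) *v y) = x + ?B *v f"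
    unfolding y by (simp add: matrix_vector_right_distrib BA)
  ultimately have eq: "l *\<^sub>R y - ?B *v y = x + ?B *v f" by simp
  have Bf: "\<bar>(?B *v f) $ i\<bar> \<le> g * x $ i" for i
    using perturbation_bound[OF inv x g(1) f] .
  have xp: "0 < x $ i" for i using x by (simp add: pos_vec_def)
  have low: "(1 - g) * x $ i \<le> (l *\<^sub>R y - ?B *v y) $ i" for i
    unfolding eq using Bf[of i] by (simp add: algebra_simps)
  show "l *\<^sub>R y - ?B *v y \<le> (1 + g) *\<^sub>R x"
    unfolding eq using Bf by (auto simp: less_eq_vec_def algebra_simps abs_le_iff)
  have pos: "0 < (l *\<^sub>R y - ?B *v y) $ i" for i
    using low[of i] xp[of i] g by (smt (verit) mult_pos_pos)
  obtain v where v: "pos_vec v" "?B *v v = spec_radius ?B *\<^sub>R v"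
    using perron_frobenius(4)[OF nn irr B0] by blast
  have r: "0 < spec_radius ?B" using perron_frobenius(3)[OF nn irr B0] .
  have y0: "0 \<le> y"
    by (rule shifted_inverse_nonneg[OF nn v l]) (use pos in \<open>auto simp: less_eq_vec_def less_imp_le\<close>)
  have yp: "0 < y $ i" for i
  proof -
    have "0 \<le> (?B *v y) $ i" using nonneg_mult_mono[OF nn y0] by (simp add: less_eq_vec_def)
    then have "0 < l * y $ i" using pos[of i] by simp
    then show ?thesis using l r by (simp add: zero_less_mult_iff)
  qed
  then show "pos_vec y" by (simp add: pos_vec_def)
  obtain i where i: "min_ratio x y = x $ i / y $ i" by (rule min_ratio_attained)
  have "0 < min_ratio x y" unfolding i using xp yp by simp
  then show "l' < l" using g by (simp add: l'_def)
  show "?B *v y \<le> l' *\<^sub>R y"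
    unfolding less_eq_vec_def
  proof
    fix i
    have "min_ratio x y * y $ i \<le> x $ i"
      using min_ratio_le[of x y i] yp[of i] by (simp add: field_simps)
    then have "(1 - g) * (min_ratio x y * y $ i) \<le> (1 - g) * x $ i"
      using g by (intro mult_left_mono) auto
    then show "(?B *v y) $ i \<le> (l' *\<^sub>R y) $ i"
      using low[of i] by (simp add: l'_def algebra_simps)
  qed
qed

theorem theorem3:
  fixes A :: "real^'n^'n"
    and gam lam :: "nat \<Rightarrow> real"
    and g :: real
    and x y f :: "nat \<Rightarrow> real^'n"
  assumes "irreducible_mat A"
    and "monotone_mat A"
    and "\<And>k. 0 \<le> gam k"
    and "\<And>k. gam k \<le> g"
    and "g < 1"
    and "inexact_noda A gam lam x y f"
    and "lam 0 > spec_radius (matrix_inv A)"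
    and "\<And>k. x k \<noteq> perron_vec (matrix_inv A)"
  shows "(\<forall>k. lam (Suc k) < lam k) \<and> (\<lambda>k. inverse (lam k)) \<longlonglongrightarrow> sigma_min A"
proof -
  let ?B = "matrix_inv A"
  define r where "r = spec_radius ?B"
  have inv: "invertible A" and nn: "\<And>i j. 0 \<le> ?B $ i $ j"
    using assms(2) by (auto simp: monotone_mat_def)
  have irr: "coord_irreducible ?B"
    using coord_irreducible_inverse[OF irreducible_no_invariant_coords[OF assms(1)] inv] .
  have B0: "?B \<noteq> 0"
  proof
    assume "?B = 0"
    then have "mat 1 = (0 :: real^'n^'n)" using invertible_matrix_inv(1)[OF inv] by simp
    then show False by (simp add: vec_eq_iff mat_def split: if_splits)
  qed
  note pf = perron_frobenius[OF nn irr B0]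
  have r0: "0 < r" using pf(3) by (simp add: r_def)
  have g1: "gam k < 1" for k using assms(4)[of k] assms(5) by simp
  have init: "pos_vec (x 0)" "norm (x 0) = 1"
    and fb: "norm (f k) \<le> gam k * sep0 A * min_entry (x k)"
    and yeq: "(lam k *\<^sub>R A - mat 1) *v y (Suc k) = A *v x k + f k"
    and xs: "x (Suc k) = y (Suc k) /\<^sub>R norm (y (Suc k))"
    and ls: "lam (Suc k) = lam k - (1 - gam k) * min_ratio (x k) (y (Suc k))" for k
    using assms(6) unfolding inexact_noda_def by blast+
  note step = noda_step[OF irr inv nn B0 _ _ assms(3) g1 fb yeq, folded ls]
  have xnext: "pos_vec (x (Suc k))" "norm (x (Suc k)) = 1"
    and Bx: "?B *v y (Suc k) \<le> c *\<^sub>R y (Suc k) \<Longrightarrow> ?B *v x (Suc k) \<le> c *\<^sub>R x (Suc k)"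
    if "pos_vec (y (Suc k))" for k c
  proof -
    have "y (Suc k) \<noteq> 0" using that by (auto simp: pos_vec_def)
    then have n: "0 < norm (y (Suc k))" by simp
    show "pos_vec (x (Suc k))" using that n by (simp add: xs pos_vec_def)
    show "norm (x (Suc k)) = 1" using n by (simp add: xs)
    show "?B *v x (Suc k) \<le> c *\<^sub>R x (Suc k)" if "?B *v y (Suc k) \<le> c *\<^sub>R y (Suc k)"
      using that n
      by (auto simp: xs matrix_vector_mult_scaleR less_eq_vec_def mult.left_commute
          intro!: mult_left_mono)
  qed
  have inv_k: "pos_vec (x k) \<and> norm (x k) = 1 \<and> r < lam k" for k
  proof (induction k)
    case 0
    show ?case using init assms(7) by (simp add: r_def)
  next
    case (Suc k)
    then have l: "spec_radius ?B < lam k" and xk: "pos_vec (x k)" by (auto simp: r_def)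
    note st = step[OF xk l]
    note xn = xnext[OF st(1)]
    have sub: "?B *v x (Suc k) \<le> lam (Suc k) *\<^sub>R x (Suc k)" using Bx[OF st(1) st(2)] .
    note cw = subinvariant_at_radius[OF nn irr B0 xn(1) sub]
    \<comment> \<open>Equality is excluded only by the hypothesis that no iterate is the Perron vector.\<close>
    have "lam (Suc k) \<noteq> r"
    proof
      assume "lam (Suc k) = r"
      then have "x (Suc k) = perron_vec ?B"
        using cw(2) by (intro perron_vec_eqI[OF nn irr B0 xn]) (simp add: r_def)
      then show False using assms(8) by blast
    qed
    then show ?case using cw(1) xn by (simp add: r_def)
  qed
  have xk: "pos_vec (x k)" and nx: "norm (x k) = 1" and lr: "r < lam k"
    and lr': "spec_radius ?B < lam k" for k
    using inv_k by (auto simp: r_def)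
  note st = step[OF xk lr']
  have dec: "lam (Suc k) < lam k" for k using st(3) .
  then have anti: "decseq lam" by (intro decseq_SucI less_imp_le)
  have l0: "lam k \<le> lam 0" for k using anti by (simp add: decseqD)
  obtain v where v: "pos_vec v" "?B *v v = r *\<^sub>R v"
    using pf(4) by (auto simp: r_def)
  have vp: "0 < v $ i" for i using v by (simp add: pos_vec_def)
  obtain d where d: "0 < d"
    and har: "\<And>v i j. 0 \<le> v \<Longrightarrow> ?B *v v \<le> lam 0 *\<^sub>R v \<Longrightarrow> d * v $ j \<le> v $ i"
    using harnack[OF nn irr, of "lam 0"] lr[of 0] r0 by (metis less_imp_le less_trans)
  \<comment> \<open>The sum of the entries of a unit vector is at least one, so some entry is at least one over the
      dimension; the Harnack inequality carries this to all entries.\<close>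
  define m where "m = d / CARD('n)"
  have m: "0 < m" using d by (simp add: m_def)
  have low: "m \<le> x (Suc k) $ i" for k i
  proof -
    let ?x = "x (Suc k)"
    have x0: "0 \<le> ?x $ j" for j using xk[of "Suc k"] by (simp add: pos_vec_def less_imp_le)
    have "?B *v ?x \<le> lam (Suc k) *\<^sub>R ?x" using Bx[OF st(1) st(2)] .
    also have "\<dots> \<le> lam 0 *\<^sub>R ?x"
      using l0[of "Suc k"] x0 by (auto simp: less_eq_vec_def intro: mult_right_mono)
    finally have h: "d * ?x $ j \<le> ?x $ i" for j
      using har x0 by (simp add: less_eq_vec_def)
    have "d = d * norm ?x" using nx by simp
    also have "\<dots> \<le> d * (\<Sum>j\<in>UNIV. \<bar>?x $ j\<bar>)"
      using d by (intro mult_left_mono norm_le_l1_cart) auto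
    also have "\<dots> = (\<Sum>j\<in>UNIV. d * ?x $ j)"
      using x0 by (simp add: sum_distrib_left)
    also have "\<dots> \<le> CARD('n) * ?x $ i"
      using sum_bounded_above[of UNIV "\<lambda>j. d * ?x $ j" "?x $ i"] h by simp
    finally show ?thesis by (simp add: m_def field_simps)
  qed
  obtain L where L: "lam \<longlonglongrightarrow> L"
    using decseq_convergent[OF anti, of r] lr by (metis less_imp_le)
  have "r \<le> L" using L lr by (intro LIMSEQ_le_const) (auto intro: less_imp_le)
  have "L = r"
  proof (rule ccontr)
    assume "L \<noteq> r"
    then have Lr: "r < L" using \<open>r \<le> L\<close> by simp
    have Ll: "L \<le> lam k" for k using anti L by (rule decseq_ge)
    define b where "b = Min (range (($) v))"
    have "b \<in> range (($) v)" unfolding b_def by (rule Min_in) auto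
    then have b: "0 < b" using vp by auto
    have bv: "b \<le> v $ i" for i unfolding b_def by (rule Min_le) auto
    \<comment> \<open>Chosen so that applying \<open>\<lambda>\<^sub>k I - B\<close> to \<open>C v\<close> gives at least 2 in each entry, whereas applying it to
      \<open>y\<^sub>k\<^sub>+\<^sub>1\<close> gives at most \<open>(1 + \<gamma>\<^sub>k) x\<^sub>k\<close>, whose entries are at most 2.\<close>
    define C where "C = 2 / (b * (L - r))"
    have C: "0 < C" using b Lr by (simp add: C_def)
    have yb: "y (Suc k) \<le> C *\<^sub>R v" for k
    proof -
      let ?u = "C *\<^sub>R v - y (Suc k)"
      have "0 \<le> lam k *\<^sub>R ?u - ?B *v ?u"
        unfolding less_eq_vec_def
      proof
        fix i
        have "x k $ i \<le> 1" using component_le_norm_cart[of "x k" i] nx[of k] by simp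
        moreover have "0 < x k $ i" using xk by (simp add: pos_vec_def)
        ultimately have "(1 + gam k) * x k $ i \<le> 2 * 1"
          using g1[of k] assms(3)[of k] by (intro mult_mono) auto
        then have "(lam k *\<^sub>R y (Suc k) - ?B *v y (Suc k)) $ i \<le> 2"
          using st(4)[of k] by (simp add: less_eq_vec_def) (meson order_trans)
        moreover have "2 = C * (L - r) * b" using b Lr by (simp add: C_def divide_simps)
        moreover have "C * (L - r) * b \<le> C * (lam k - r) * v $ i"
          using C Lr Ll[of k] b bv[of i] by (intro mult_mono) auto
        ultimately show "0 $ i \<le> (lam k *\<^sub>R ?u - ?B *v ?u) $ i"
          by (simp add: matrix_vector_mult_diff_distrib matrix_vector_mult_scaleR v algebra_simps)
      qed
      then have "0 \<le> ?u" by (rule shifted_inverse_nonneg[OF nn v lr])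
      then show ?thesis by (simp add: less_eq_vec_def)
    qed
    define V where "V = Max (range (($) v))"
    have vV: "v $ i \<le> V" for i unfolding V_def by (rule Max_ge) auto
    have V: "0 < V" using vV vp by (meson less_le_trans)
    define e where "e = (1 - g) * (m / (C * V))"
    have e: "0 < e" using assms(5) m C V by (simp add: e_def)
    \<comment> \<open>The starting vector need not satisfy the lower bound \<open>m\<close>, hence the index shift.\<close>
    have drop: "lam (Suc (Suc k)) \<le> lam (Suc k) - e" for k
    proof -
      let ?y = "y (Suc (Suc k))"
      obtain i where i: "min_ratio (x (Suc k)) ?y = x (Suc k) $ i / ?y $ i"
        by (rule min_ratio_attained)
      have "?y $ i \<le> C * v $ i" using yb by (simp add: less_eq_vec_def)
      also have "\<dots> \<le> C * V" using C vV by simp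
      finally have yi: "?y $ i \<le> C * V" .
      have "0 < ?y $ i" using st(1) by (simp add: pos_vec_def)
      then have "m / (C * V) \<le> min_ratio (x (Suc k)) ?y"
        unfolding i using low m yi by (intro frac_le) (auto intro: order_trans less_imp_le)
      then have "e \<le> (1 - gam (Suc k)) * min_ratio (x (Suc k)) ?y"
        unfolding e_def using assms(4)[of "Suc k"] g1[of "Suc k"] m C V by (intro mult_mono) auto
      then show ?thesis by (simp add: ls[of "Suc k"])
    qed
    have "(\<lambda>k. lam (Suc (Suc k))) \<longlonglongrightarrow> L" "(\<lambda>k. lam (Suc k) - e) \<longlonglongrightarrow> L - e"
      using L by (auto intro!: tendsto_intros LIMSEQ_Suc)
    then have "L \<le> L - e" using drop by (intro LIMSEQ_le) auto
    then show False using e by simp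
  qed
  then have "(\<lambda>k. inverse (lam k)) \<longlonglongrightarrow> inverse r"
    using L r0 by (intro tendsto_inverse) auto
  moreover have "sigma_min A = inverse r"
    unfolding r_def by (rule sigma_min_eq_inverse_spec_radius[OF inv pf(1-3)])
  ultimately show ?thesis using dec by simp
qed

end
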